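(* Let $T \subset \mathbb{R}^2$ be a convex polygon (compact, with non-empty interior). For an edge $e$ of $T$, denote by $\overline{e}$ the line supporting $e$ and by $\mathring{e}$ the relative interior of $e$. Then: (i) If $\partial T$ has two parallel edges $e_i, e_j$, then the segments orthogonal to $e_i$ and $e_j$ with one end point on $\mathring{e}_i$ and the other on $\mathring{e}_j$ form (traversed back and forth) regular $2$-bounce orbits on $T$, and all regular $2$-bounce orbits on $T$ are of this form. (ii) Given a vertex $v$ of $T$ and an edge $e$ of $T$ not containing $v$, let $s$ be the altitude (perpendicular segment) from $v$ to $\overline{e}$. Then $s$ is half of a generalised $2$-bounce orbit on $T$ if and only if the end point of $s$ on $\overline{e}$ lies on $e$ and the line through $v$ orthogonal to $s$ is disjoint from the interior of $T$. (iii) Given two different vertices $v_i, v_j$ of $T$, the segment $s = v_iv_j$ is half of a generalised $2$-bounce orbit on $T$ if and only if the lines through $v_i$ and $v_j$ orthogonal to $s$ are both disjoint from the interior of $T$. Every generalised $2$-bounce orbit on $T$ arises in (i), (ii) or (iii).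
   Context: An outward support vector of $T$ at $q\in\partial T$ is a vector $\nu$ with $\langle x-q,\nu\rangle\le0$ for all $x\in T$. A point $q\in\partial T$ is smooth if there is a unique line through $q$ disjoint from the interior of $T$. A generalised billiard orbit on $T$ is a sequence $q_i\in\partial T$, $i\in\mathbb{Z}$ (consecutive points distinct), such that for every $i$ the vector $\frac{q_i-q_{i-1}}{\|q_i-q_{i-1}\|}+\frac{q_i-q_{i+1}}{\|q_i-q_{i+1}\|}$ is an outward support vector of $T$ at $q_i$; it is regular if all the points $q_i$ (bounce points) are smooth. It is closed if $q_{i+n}=q_i$ for all $i$ for some $n\ge2$, and an $n$-bounce orbit if $n$ is the smallest such integer. Closed orbits with the same trace are identified. A segment $s=ab$ is "half of" a generalised $2$-bounce orbit if the sequence alternating between $a$ and $b$ is a generalised billiard orbit. *)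

theory Defs
  imports "HOL-Analysis.Analysis"
begin

type_synonym plane = "real^2"

definition convex_polygon :: "plane set \<Rightarrow> bool" where
  "convex_polygon T \<longleftrightarrow> polytope T \<and> interior T \<noteq> {}"

definition is_line :: "plane set \<Rightarrow> bool" where
  "is_line L \<longleftrightarrow> affine L \<and> aff_dim L = 1"

definition smooth_point :: "plane set \<Rightarrow> plane \<Rightarrow> bool" where
  "smooth_point T q \<longleftrightarrow>
     q \<in> frontier T \<and> (\<exists>!L. is_line L \<and> q \<in> L \<and> disjnt L (interior T))"

text \<open>The zero vector is admitted as an outward support vector.\<close>

definition outward_support_vector :: "plane set \<Rightarrow> plane \<Rightarrow> plane \<Rightarrow> bool" where
  "outward_support_vector T q \<nu> \<longleftrightarrow> q \<in> frontier T \<and> (\<forall>x\<in>T. (x - q) \<bullet> \<nu> \<le> 0)"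

definition generalised_billiard_orbit :: "plane set \<Rightarrow> (int \<Rightarrow> plane) \<Rightarrow> bool" where
  "generalised_billiard_orbit T q \<longleftrightarrow>
     (\<forall>i. q i \<in> frontier T) \<and>
     (\<forall>i. q i \<noteq> q (i + 1)) \<and>
     (\<forall>i. outward_support_vector T (q i)
            ((q i - q (i - 1)) /\<^sub>R norm (q i - q (i - 1)) +
             (q i - q (i + 1)) /\<^sub>R norm (q i - q (i + 1))))"

definition regular_orbit :: "plane set \<Rightarrow> (int \<Rightarrow> plane) \<Rightarrow> bool" where
  "regular_orbit T q \<longleftrightarrow> generalised_billiard_orbit T q \<and> (\<forall>i. smooth_point T (q i))"

definition has_period :: "(int \<Rightarrow> plane) \<Rightarrow> nat \<Rightarrow> bool" where
  "has_period q n \<longleftrightarrow> n \<ge> 2 \<and> (\<forall>i. q (i + int n) = q i)"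

definition n_bounce_orbit :: "plane set \<Rightarrow> nat \<Rightarrow> (int \<Rightarrow> plane) \<Rightarrow> bool" where
  "n_bounce_orbit T n q \<longleftrightarrow>
     generalised_billiard_orbit T q \<and> has_period q n \<and> (\<forall>m. has_period q m \<longrightarrow> n \<le> m)"

text \<open>Closed orbits are identified when they have the same trace; assertions that a given orbit
  is one of a list of orbits are therefore expressed as equality of traces.\<close>

definition orbit_trace :: "(int \<Rightarrow> plane) \<Rightarrow> plane set" where
  "orbit_trace q = (\<Union>i. closed_segment (q i) (q (i + 1)))"

definition alternating :: "plane \<Rightarrow> plane \<Rightarrow> int \<Rightarrow> plane" where
  "alternating a b i = (if even i then a else b)"

definition half_of_2_bounce :: "plane set \<Rightarrow> plane \<Rightarrow> plane \<Rightarrow> bool" where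
  "half_of_2_bounce T a b \<longleftrightarrow> generalised_billiard_orbit T (alternating a b)"

definition parallel_edges :: "plane set \<Rightarrow> plane set \<Rightarrow> plane set \<Rightarrow> bool" where
  "parallel_edges T e e' \<longleftrightarrow>
     e edge_of T \<and> e' edge_of T \<and> e \<noteq> e' \<and> affine_parallel (affine hull e) (affine hull e')"

definition segment_orthogonal_to :: "plane \<Rightarrow> plane \<Rightarrow> plane set \<Rightarrow> bool" where
  "segment_orthogonal_to a b e \<longleftrightarrow>
     (\<forall>x \<in> affine hull e. \<forall>y \<in> affine hull e. orthogonal (b - a) (y - x))"

text \<open>The segment from \<open>v\<close> to \<open>p\<close> is the altitude from \<open>v\<close> to the line supporting \<open>e\<close>.\<close>

definition altitude :: "plane \<Rightarrow> plane \<Rightarrow> plane set \<Rightarrow> bool" where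
  "altitude v p e \<longleftrightarrow> p \<in> affine hull e \<and> segment_orthogonal_to v p e"

text \<open>The line through \<open>c\<close> orthogonal to the segment \<open>a b\<close>; it is a line only if \<open>a \<noteq> b\<close>.\<close>

definition orthogonal_line :: "plane \<Rightarrow> plane \<Rightarrow> plane \<Rightarrow> plane set" where
  "orthogonal_line c a b = {x. orthogonal (x - c) (b - a)}"

end

theory Submission
  imports Defs
begin

text \<open>
  A 2-bounce orbit runs back and forth along one segment \<open>a b\<close>, and the reflection law at \<open>a\<close> says
  that \<open>a - b\<close> is a support vector there. Since \<open>b\<close> itself lies in \<open>T\<close>, there is only one
  side of the line through \<open>a\<close> orthogonal to the segment on which \<open>T\<close> can lie, so the law holds
  exactly when that line misses the interior of \<open>T\<close>; thus a segment between boundary points is half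
  of a generalised 2-bounce orbit if and only if the orthogonal lines at both of its ends miss the
  interior (\<open>half_of_2_bounce_iff\<close>). This is already the assertion about two vertices.

  The rest concerns how such lines touch a polygon. A boundary point is either a vertex or
  relatively interior to an edge (\<open>frontier_point_cases\<close>). In the latter case any line through it
  that misses the interior cuts \<open>T\<close> in a face, which must contain the whole edge; so the
  supporting line is unique (\<open>supporting_line_at_edge_point\<close>) and the bouncing segment
  is orthogonal to the edge. At a vertex there are at least two such lines, that of an adjacent
  edge and one that exposes the vertex (\<open>vertex_not_smooth\<close>). Hence regular orbits are those
  with both ends inside edges, the two edges being orthogonal to one segment and therefore
  parallel, and the classification is the case distinction between vertices and
  edges at the two ends.
\<close>

section \<open>Orthogonal lines and the reflection law\<close>

lemma orthogonal_line_swap: "orthogonal_line c a b = orthogonal_line c b a"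
  by (auto simp: orthogonal_line_def orthogonal_def inner_diff_right)

lemma orthogonal_line_eq_hyperplane: "orthogonal_line c a b = {x. (b - a) \<bullet> x = (b - a) \<bullet> c}"
  by (auto simp: orthogonal_line_def orthogonal_def inner_diff_left inner_diff_right inner_commute)

lemma is_line_hyperplane:
  fixes n :: plane
  assumes "n \<noteq> 0"
  shows "is_line {x. n \<bullet> x = c}"
  using assms by (simp add: is_line_def affine_hyperplane aff_dim_hyperplane)

lemma is_line_orthogonal_line:
  assumes "a \<noteq> b"
  shows "is_line (orthogonal_line c a b)"
  using assms by (simp add: orthogonal_line_eq_hyperplane is_line_hyperplane)

lemma is_line_subset_eq:
  assumes "is_line L" "is_line M" "L \<subseteq> M"
  shows "L = M"
proof -
  have "L \<noteq> {}" using assms(1) by (auto simp: is_line_def)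
  then show ?thesis using assms affine_dim_equal[of L M] by (simp add: is_line_def)
qed

lemma is_line_hyperplaneE:
  assumes "is_line L"
  obtains n c where "n \<noteq> 0" "L = {x. n \<bullet> x = c}"
proof -
  have hull: "affine hull L = L" using assms by (simp add: is_line_def affine_hull_eq)
  have "aff_dim L = int (DIM(plane) - 1)" using assms by (simp add: is_line_def)
  then have "\<exists>n c. n \<noteq> 0 \<and> affine hull L = {x. n \<bullet> x = c}"
    by (rule iffD1[OF aff_dim_eq_hyperplane])
  then show thesis unfolding hull using that by auto
qed

lemma hyperplane_interior_sides:
  fixes T :: "'a::euclidean_space set"
  assumes "convex T" "interior T \<noteq> {}" "disjnt {x. n \<bullet> x = c} (interior T)"
  shows "(\<forall>x\<in>T. n \<bullet> x \<le> c) \<or> (\<forall>x\<in>T. c \<le> n \<bullet> x)"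
proof (rule ccontr)
  assume "\<not> ?thesis"
  then obtain x y where xy: "x \<in> T" "y \<in> T" "c < n \<bullet> x" "n \<bullet> y < c" by force
  \<comment> \<open>Both points can be moved into the interior, which is connected.\<close>
  have cl: "T \<subseteq> closure (interior T)"
    using assms(1,2) convex_closure_interior closure_subset by blast
  have "open {z. c < n \<bullet> z}" "open {z. n \<bullet> z < c}"
    by (rule open_halfspace_gt, rule open_halfspace_lt)
  then have "interior T \<inter> {z. c < n \<bullet> z} \<noteq> {}" "interior T \<inter> {z. n \<bullet> z < c} \<noteq> {}"
    using xy cl open_Int_closure_eq_empty by blast+
  then obtain x' y' where "x' \<in> interior T" "y' \<in> interior T" "c \<le> n \<bullet> x'" "n \<bullet> y' \<le> c"
    by force
  moreover have "connected (interior T)"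
    using assms(1) by (simp add: convex_connected convex_interior)
  ultimately obtain z where "z \<in> interior T" "n \<bullet> z = c"
    using connected_ivt_hyperplane[of "interior T" y' x' n c] by blast
  then show False using assms(3) by (auto simp: disjnt_iff)
qed

text \<open>The point \<open>b\<close> of \<open>T\<close> decides on which side of the line the body lies.\<close>

lemma outward_support_vector_iff_disjnt:
  assumes "convex T" "interior T \<noteq> {}" "b \<in> T" "a \<in> frontier T" "a \<noteq> b"
  shows "outward_support_vector T a (a - b) \<longleftrightarrow> disjnt (orthogonal_line a a b) (interior T)"
proof
  assume supp: "outward_support_vector T a (a - b)"
  have "T \<subseteq> {x. (b - a) \<bullet> x \<ge> (b - a) \<bullet> a}"
    using supp by (force simp: outward_support_vector_def inner_diff_left inner_diff_right inner_commute)
  then have "interior T \<subseteq> {x. (b - a) \<bullet> x > (b - a) \<bullet> a}"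
    using assms(5) interior_mono interior_halfspace_ge by (metis right_minus_eq)
  then show "disjnt (orthogonal_line a a b) (interior T)"
    by (auto simp: orthogonal_line_eq_hyperplane disjnt_iff)
next
  assume "disjnt (orthogonal_line a a b) (interior T)"
  then have "(\<forall>x\<in>T. (b - a) \<bullet> x \<le> (b - a) \<bullet> a) \<or> (\<forall>x\<in>T. (b - a) \<bullet> a \<le> (b - a) \<bullet> x)"
    using hyperplane_interior_sides[OF assms(1,2)] by (simp add: orthogonal_line_eq_hyperplane)
  moreover have "\<not> (b - a) \<bullet> b \<le> (b - a) \<bullet> a"
    using assms(5) inner_gt_zero_iff[of "b - a"] by (simp add: inner_diff_right)
  ultimately have "\<forall>x\<in>T. (b - a) \<bullet> a \<le> (b - a) \<bullet> x" using assms(3) by blast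
  then show "outward_support_vector T a (a - b)"
    using assms(4)
    by (force simp: outward_support_vector_def inner_diff_left inner_diff_right inner_commute)
qed

lemma outward_support_vector_scaleR:
  assumes "c > 0"
  shows "outward_support_vector T q (c *\<^sub>R \<nu>) \<longleftrightarrow> outward_support_vector T q \<nu>"
  using assms by (simp add: outward_support_vector_def mult_le_0_iff)

lemma all_alternating: "(\<forall>i::int. P (even i)) \<longleftrightarrow> P True \<and> P False"
  by (metis (full_types) even_zero odd_one)

lemma half_of_2_bounce_iff_support:
  "half_of_2_bounce T a b \<longleftrightarrow>
     a \<noteq> b \<and> outward_support_vector T a (a - b) \<and> outward_support_vector T b (b - a)"
proof (cases "a = b")
  case True
  then show ?thesis
    by (simp add: half_of_2_bounce_def generalised_billiard_orbit_def alternating_def)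
next
  case False
  \<comment> \<open>Both unit vectors in the reflection law coincide, which gives the factor 2.\<close>
  have *: "outward_support_vector T x ((x - y) /\<^sub>R norm (x - y) + (x - y) /\<^sub>R norm (x - y))
      \<longleftrightarrow> outward_support_vector T x (x - y)" if "x \<noteq> y" for x y
    using that outward_support_vector_scaleR[of "2 / norm (x - y)" T x "x - y"]
    by (simp add: scaleR_2[symmetric] divide_inverse)
  have "half_of_2_bounce T a b \<longleftrightarrow>
      (a \<in> frontier T \<and> b \<in> frontier T) \<and>
      outward_support_vector T a ((a - b) /\<^sub>R norm (a - b) + (a - b) /\<^sub>R norm (a - b)) \<and>
      outward_support_vector T b ((b - a) /\<^sub>R norm (b - a) + (b - a) /\<^sub>R norm (b - a))"
    unfolding half_of_2_bounce_def generalised_billiard_orbit_def alternating_def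
    using False
    all_alternating[of "\<lambda>p. (if p then a else b) \<in> frontier T"]
    all_alternating[of "\<lambda>p. (if p then a else b) \<noteq> (if \<not> p then a else b)"]
    all_alternating[of "\<lambda>p. outward_support_vector T (if p then a else b)
      (((if p then a else b) - (if \<not> p then a else b)) /\<^sub>R
         norm ((if p then a else b) - (if \<not> p then a else b)) +
       ((if p then a else b) - (if \<not> p then a else b)) /\<^sub>R
         norm ((if p then a else b) - (if \<not> p then a else b)))"]
    by (simp only: even_plus_one_iff even_diff odd_one) auto
  then show ?thesis using * False by (auto simp: outward_support_vector_def)
qed

lemma half_of_2_bounce_iff:
  assumes "convex T" "closed T" "interior T \<noteq> {}"
  shows "half_of_2_bounce T a b \<longleftrightarrow>
     a \<in> frontier T \<and> b \<in> frontier T \<and> a \<noteq> b \<and>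
     disjnt (orthogonal_line a a b) (interior T) \<and> disjnt (orthogonal_line b a b) (interior T)"
proof (cases "a \<in> frontier T \<and> b \<in> frontier T \<and> a \<noteq> b")
  case True
  then have "a \<in> T" "b \<in> T" using assms(2) frontier_subset_closed by blast+
  then show ?thesis
    using True assms outward_support_vector_iff_disjnt[of T b a]
      outward_support_vector_iff_disjnt[of T a b] orthogonal_line_swap[of b a b]
    by (auto simp: half_of_2_bounce_iff_support)
next
  case False
  then show ?thesis by (auto simp: half_of_2_bounce_iff_support outward_support_vector_def)
qed

section \<open>Periodic sequences\<close>

lemma has_period_2_alternating: "has_period q 2 \<longleftrightarrow> q = alternating (q 0) (q 1)"
proof
  assume "has_period q 2"
  then have shift: "q (i + 2) = q i" for i by (simp add: has_period_def)
  have up: "q (k + 2 * int n) = q k" for k n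
  proof (induction n)
    case (Suc n)
    have "k + 2 * int (Suc n) = (k + 2 * int n) + 2" by simp
    then show ?case using Suc shift by metis
  qed simp
  have "q (k + 2 * m) = q k" for k m
    using up[of k "nat m"] up[of "k + 2 * m" "nat (- m)"] by (cases "m \<ge> 0") auto
  from this[of 0] this[of 1] have "q (2 * m) = q 0" "q (2 * m + 1) = q 1" for m
    by (simp_all add: add.commute)
  then have "q i = alternating (q 0) (q 1) i" for i
    by (cases "even i") (auto simp: alternating_def elim!: evenE oddE)
  then show "q = alternating (q 0) (q 1)" by blast
next
  assume "q = alternating (q 0) (q 1)"
  then have "q i = (if even i then q 0 else q 1)" for i by (metis alternating_def)
  then show "has_period q 2" unfolding has_period_def by simp
qed

lemma n_bounce_orbit_2_iff:
  "n_bounce_orbit T 2 q \<longleftrightarrow> q = alternating (q 0) (q 1) \<and> half_of_2_bounce T (q 0) (q 1)"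
  using has_period_2_alternating[of q]
  by (auto simp: n_bounce_orbit_def half_of_2_bounce_def has_period_def)

lemma n_bounce_orbit_2_alternating:
  "n_bounce_orbit T 2 (alternating a b) \<longleftrightarrow> half_of_2_bounce T a b"
  using n_bounce_orbit_2_iff[of T "alternating a b"] by (simp add: alternating_def[abs_def])

lemma orbit_trace_alternating: "orbit_trace (alternating a b) = closed_segment a b"
proof -
  have "closed_segment (alternating a b i) (alternating a b (i + 1)) = closed_segment a b" for i
    by (cases "even i") (simp_all add: alternating_def closed_segment_commute del: segment_convex_hull)
  then show ?thesis unfolding orbit_trace_def by blast
qed

lemma orbit_trace_alternating_swap: "orbit_trace (alternating a b) = orbit_trace (alternating b a)"
  by (simp add: orbit_trace_alternating closed_segment_commute)

section \<open>Supporting lines of a convex polygon\<close>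

lemma convex_polygonD:
  assumes "convex_polygon T"
  shows "convex T" "closed T" "polyhedron T" "interior T \<noteq> {}" "aff_dim T = 2"
  using assms
  by (auto simp: convex_polygon_def polytope_imp_convex polytope_imp_closed
      polytope_imp_polyhedron aff_dim_nonempty_interior)

lemma is_line_affine_hull_edge:
  assumes "e edge_of T"
  shows "is_line (affine hull e)"
  using assms by (simp add: edge_of_def is_line_def)

lemma edge_subset_frontier:
  assumes "convex_polygon T" "e edge_of T"
  shows "e \<subseteq> frontier T"
proof -
  have "e face_of T" "e \<noteq> T" using assms convex_polygonD[OF assms(1)] by (auto simp: edge_of_def)
  then have "disjnt e (interior T)" "e \<subseteq> T"
    using face_of_disjoint_interior[of e T] face_of_imp_subset[of e T] by (auto simp: disjnt_def)
  then show ?thesis by (auto simp: disjnt_iff frontier_def intro: subsetD[OF closure_subset])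
qed

lemma affine_hull_edge_Int:
  assumes "convex_polygon T" "e edge_of T"
  shows "affine hull e \<inter> T = e"
  using assms convex_polygonD[OF assms(1)] face_of_imp_eq_affine_Int[of T e]
  by (auto simp: edge_of_def)

lemma affine_hull_edge_disjnt_interior:
  assumes "convex_polygon T" "e edge_of T"
  shows "disjnt (affine hull e) (interior T)"
  using affine_hull_edge_Int[OF assms] edge_subset_frontier[OF assms] interior_subset[of T]
  by (auto simp: disjnt_iff frontier_def)

lemma vertex_in_frontier:
  assumes "convex_polygon T" "v extreme_point_of T"
  shows "v \<in> frontier T"
  using assms extreme_point_not_in_interior[of v T] closure_subset[of T]
  by (auto simp: frontier_def extreme_point_of_def)

lemma frontier_point_in_edge:
  assumes "convex_polygon T" "x \<in> frontier T"
  obtains e where "e edge_of T" "x \<in> e"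
proof -
  have "x \<in> rel_frontier T"
    using assms convex_polygonD[OF assms(1)] by (simp add: rel_frontier_nonempty_interior)
  then obtain e where "e facet_of T" "x \<in> e"
    using rel_frontier_of_polyhedron[OF convex_polygonD(3)[OF assms(1)]] by auto
  then show thesis
    using that convex_polygonD(5)[OF assms(1)] by (auto simp: facet_of_def edge_of_def)
qed

text \<open>
  The boundary of a polyhedron is the union of its facets. For the polygon these are edges, for an
  edge they are single points, and faces of faces are faces.
\<close>

lemma frontier_point_cases [consumes 2]:
  assumes "convex_polygon T" "x \<in> frontier T"
  obtains (vertex) "x extreme_point_of T" | (edge) e where "e edge_of T" "x \<in> rel_interior e"
proof -
  obtain e where e: "e edge_of T" "x \<in> e" using frontier_point_in_edge[OF assms] .
  show thesis
  proof (cases "x \<in> rel_interior e")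
    case True
    then show thesis using e edge by blast
  next
    case False
    have pe: "polyhedron e"
      using e convex_polygonD(3)[OF assms(1)] face_of_polyhedron_polyhedron
      by (auto simp: edge_of_def)
    have "x \<in> rel_frontier e"
      using False e closure_subset by (auto simp: rel_frontier_def)
    then obtain F where F: "F facet_of e" "x \<in> F"
      using rel_frontier_of_polyhedron[OF pe] by auto
    then have "aff_dim F = 0" using e by (simp add: facet_of_def edge_of_def)
    then have "F = {x}" using F(2) by (auto simp: aff_dim_eq_0)
    then have "{x} face_of T" using F e face_of_trans by (auto simp: facet_of_def edge_of_def)
    then show thesis using vertex by (simp add: face_of_singleton)
  qed
qed

text \<open>
  A line that misses the interior cuts the polygon in a face. A face that meets the relative
  interior of an edge contains that edge, and a line is determined by an edge that it contains.
\<close>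

lemma supporting_line_at_edge_point:
  assumes "convex_polygon T" "e edge_of T" "a \<in> rel_interior e"
    and "is_line L" "a \<in> L" "disjnt L (interior T)"
  shows "L = affine hull e"
proof -
  note T = convex_polygonD[OF assms(1)]
  obtain n c where L: "n \<noteq> 0" "L = {x. n \<bullet> x = c}" using is_line_hyperplaneE[OF assms(4)] .
  have "(T \<inter> L) face_of T"
    using hyperplane_interior_sides[of T n c] T assms(6)
      face_of_Int_supporting_hyperplane_le[where S = T and a = n and b = c]
      face_of_Int_supporting_hyperplane_ge[where S = T and a = n and b = c]
    by (auto simp: L(2))
  moreover have "e \<subseteq> T" using assms(2) face_of_imp_subset by (auto simp: edge_of_def)
  moreover have "a \<in> T" using assms(3) \<open>e \<subseteq> T\<close> rel_interior_subset by blast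
  ultimately have "e \<subseteq> T \<inter> L"
    using assms(3,5) subset_of_face_of[of "T \<inter> L" T e] by (auto simp: disjnt_iff)
  then have "affine hull e \<subseteq> L" using assms(4) by (simp add: hull_minimal is_line_def)
  then show ?thesis
    using is_line_subset_eq[OF is_line_affine_hull_edge[OF assms(2)] assms(4)] by simp
qed

lemma edge_point_smooth:
  assumes "convex_polygon T" "e edge_of T" "a \<in> rel_interior e"
  shows "smooth_point T a"
proof -
  have "a \<in> e" using assms(3) rel_interior_subset by blast
  then show ?thesis
    using edge_subset_frontier[OF assms(1,2)] is_line_affine_hull_edge[OF assms(2)]
      affine_hull_edge_disjnt_interior[OF assms(1,2)] supporting_line_at_edge_point[OF assms]
      hull_inc[of a e affine]
    unfolding smooth_point_def by blast
qed

text \<open>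
  The line that exposes a vertex meets the polygon in nothing else, so it differs from the line
  that supports an adjacent edge.
\<close>

lemma vertex_not_smooth:
  assumes "convex_polygon T" "v extreme_point_of T"
  shows "\<not> smooth_point T v"
proof
  assume smooth: "smooth_point T v"
  note T = convex_polygonD[OF assms(1)]
  have "{v} face_of T" using assms(2) by (simp add: face_of_singleton)
  then have "{v} exposed_face_of T" using T(3) exposed_face_of_polyhedron by blast
  moreover have "T \<noteq> {v}" using T(5) by auto
  ultimately obtain n c where n: "n \<noteq> 0" "T \<subseteq> {x. n \<bullet> x \<le> c}" "{v} = T \<inter> {x. n \<bullet> x = c}"
    using exposed_face_of[of "{v}" T] by auto
  have "interior T \<subseteq> {x. n \<bullet> x < c}"
    using n(1,2) interior_mono interior_halfspace_le by metis
  then have "disjnt {x. n \<bullet> x = c} (interior T)" by (auto simp: disjnt_iff)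
  moreover obtain e where e: "e edge_of T" "v \<in> e"
    using frontier_point_in_edge[OF assms(1) vertex_in_frontier[OF assms]] .
  ultimately have "affine hull e = {x. n \<bullet> x = c}"
    using smooth n(1,3) is_line_hyperplane[of n c] is_line_affine_hull_edge[OF e(1)]
      affine_hull_edge_disjnt_interior[OF assms(1) e(1)] hull_inc[of v e affine]
    unfolding smooth_point_def by blast
  then have "e = {v}" using affine_hull_edge_Int[OF assms(1) e(1)] n(3) by blast
  then show False using e(1) by (simp add: edge_of_def)
qed

section \<open>Segments orthogonal to edges\<close>

lemma affine_hull_edge_eq_orthogonal_line:
  assumes "e edge_of T" "c \<in> affine hull e" "a \<noteq> b" "segment_orthogonal_to a b e"
  shows "affine hull e = orthogonal_line c a b"
proof (rule is_line_subset_eq)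
  show "affine hull e \<subseteq> orthogonal_line c a b"
    using assms(2,4)
    by (auto simp: segment_orthogonal_to_def orthogonal_line_def orthogonal_commute)
qed (use assms is_line_affine_hull_edge is_line_orthogonal_line in auto)

lemma segment_orthogonal_toI:
  assumes "affine hull e = orthogonal_line c a b"
  shows "segment_orthogonal_to a b e"
  unfolding segment_orthogonal_to_def assms orthogonal_line_eq_hyperplane
  by (simp add: orthogonal_def inner_diff_right)

lemma parallel_orthogonal_lines:
  "affine_parallel (orthogonal_line c a b) (orthogonal_line d a b)"
  unfolding affine_parallel_def
proof (intro exI[of _ "d - c"] set_eqI iffI)
  fix x assume "x \<in> orthogonal_line d a b"
  then have "x - (d - c) \<in> orthogonal_line c a b"
    by (auto simp: orthogonal_line_def algebra_simps)
  then show "x \<in> (+) (d - c) ` orthogonal_line c a b" by (force intro: image_eqI)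
qed (auto simp: orthogonal_line_def algebra_simps)

lemma not_mem_orthogonal_line_other_end:
  assumes "a \<noteq> b"
  shows "b \<notin> orthogonal_line a a b"
  using assms by (auto simp: orthogonal_line_def orthogonal_def)

lemma half_of_2_bounce_edge_end:
  assumes "convex_polygon T" "half_of_2_bounce T a b" "e edge_of T" "a \<in> rel_interior e"
  shows "affine hull e = orthogonal_line a a b" "b \<notin> e"
proof -
  have ab: "a \<noteq> b" "disjnt (orthogonal_line a a b) (interior T)"
    using assms(2) half_of_2_bounce_iff[of T a b] convex_polygonD[OF assms(1)] by auto
  show eq: "affine hull e = orthogonal_line a a b"
    using supporting_line_at_edge_point[OF assms(1,3,4) is_line_orthogonal_line[OF ab(1)] _ ab(2)]
    by (simp add: orthogonal_line_def orthogonal_def)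
  show "b \<notin> e" using not_mem_orthogonal_line_other_end[OF ab(1)] eq hull_inc[of b e affine] by blast
qed

lemma half_of_2_bounce_commute: "half_of_2_bounce T a b \<longleftrightarrow> half_of_2_bounce T b a"
  by (auto simp: half_of_2_bounce_iff_support)

section \<open>The classification\<close>

lemma parallel_edges_imp_orbit:
  assumes "convex_polygon T" "parallel_edges T e e'" "a \<in> rel_interior e" "b \<in> rel_interior e'"
    and "segment_orthogonal_to a b e" "segment_orthogonal_to a b e'"
  shows "half_of_2_bounce T a b" "regular_orbit T (alternating a b)"
proof -
  note T = convex_polygonD[OF assms(1)]
  have e: "e edge_of T" "e' edge_of T" "e \<noteq> e'" using assms(2) by (auto simp: parallel_edges_def)
  have mem: "a \<in> e" "b \<in> e'" using assms(3,4) rel_interior_subset by blast+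
  \<comment> \<open>Distinct faces have disjoint relative interiors.\<close>
  have "a \<noteq> b"
    using e assms(3,4) face_of_eq[of e T e'] by (auto simp: edge_of_def disjnt_iff)
  then have "affine hull e = orthogonal_line a a b" "affine hull e' = orthogonal_line b a b"
    using e mem assms(5,6) by (simp_all add: affine_hull_edge_eq_orthogonal_line hull_inc)
  then have "disjnt (orthogonal_line a a b) (interior T)" "disjnt (orthogonal_line b a b) (interior T)"
    using e affine_hull_edge_disjnt_interior[OF assms(1)] by metis+
  moreover have "a \<in> frontier T" "b \<in> frontier T"
    using mem e edge_subset_frontier[OF assms(1)] by blast+
  ultimately show half: "half_of_2_bounce T a b"
    using half_of_2_bounce_iff[of T a b] T \<open>a \<noteq> b\<close> by blast
  have "smooth_point T a" "smooth_point T b"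
    using edge_point_smooth[OF assms(1)] e assms(3,4) by blast+
  then show "regular_orbit T (alternating a b)"
    using half by (simp add: regular_orbit_def half_of_2_bounce_def alternating_def)
qed

lemma orbit_between_edges:
  assumes "convex_polygon T" "half_of_2_bounce T a b"
    and "e edge_of T" "a \<in> rel_interior e" "e' edge_of T" "b \<in> rel_interior e'"
  shows "parallel_edges T e e'" "segment_orthogonal_to a b e" "segment_orthogonal_to a b e'"
proof -
  have e: "affine hull e = orthogonal_line a a b" "b \<notin> e"
    using half_of_2_bounce_edge_end[OF assms(1-4)] .
  have "half_of_2_bounce T b a" using assms(2) half_of_2_bounce_commute by blast
  then have e': "affine hull e' = orthogonal_line b a b"
    using half_of_2_bounce_edge_end(1)[OF assms(1) _ assms(5,6)] orthogonal_line_swap by blast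
  show "segment_orthogonal_to a b e" "segment_orthogonal_to a b e'"
    using e e' segment_orthogonal_toI by blast+
  have "b \<in> e'" using assms(6) rel_interior_subset by blast
  then show "parallel_edges T e e'"
    using e e' assms(3,5) parallel_orthogonal_lines by (auto simp: parallel_edges_def)
qed

lemma orbit_between_vertex_and_edge:
  assumes "convex_polygon T" "half_of_2_bounce T v p" "e edge_of T" "p \<in> rel_interior e"
  shows "v \<notin> e" "altitude v p e" "p \<in> e" "disjnt (orthogonal_line v v p) (interior T)"
proof -
  have "half_of_2_bounce T p v" using assms(2) half_of_2_bounce_commute by blast
  note e = half_of_2_bounce_edge_end[OF assms(1) this assms(3,4)]
  show "v \<notin> e" by (rule e)
  show "p \<in> e" using assms(4) rel_interior_subset by blast
  then show "altitude v p e"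
    using e(1) segment_orthogonal_toI[of e p v p] orthogonal_line_swap[of p p v] hull_inc[of p e affine]
    unfolding altitude_def by metis
  show "disjnt (orthogonal_line v v p) (interior T)"
    using assms(2) half_of_2_bounce_iff[of T v p] convex_polygonD[OF assms(1)] by blast
qed

text \<open>
  Since \<open>v\<close> is off the supporting line of \<open>e\<close>, the orthogonal line at the foot \<open>p\<close> is that line.
  It misses the interior anyway, so at \<open>p\<close> the only condition is that \<open>p\<close> lies on the boundary.
\<close>

lemma half_of_2_bounce_altitude_iff:
  assumes "convex_polygon T" "v extreme_point_of T" "e edge_of T" "v \<notin> e" "altitude v p e"
  shows "half_of_2_bounce T v p \<longleftrightarrow> p \<in> e \<and> disjnt (orthogonal_line v v p) (interior T)"
proof -
  note T = convex_polygonD[OF assms(1)]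
  have p: "p \<in> affine hull e" "segment_orthogonal_to v p e"
    using assms(5) by (auto simp: altitude_def)
  have inT: "affine hull e \<inter> T = e" using affine_hull_edge_Int[OF assms(1,3)] .
  then have "v \<noteq> p" using assms(2,4) p(1) by (auto simp: extreme_point_of_def)
  then have "affine hull e = orthogonal_line p v p"
    using affine_hull_edge_eq_orthogonal_line[OF assms(3) p(1) _ p(2)] by blast
  then have "disjnt (orthogonal_line p v p) (interior T)"
    using affine_hull_edge_disjnt_interior[OF assms(1,3)] by simp
  moreover have "p \<in> frontier T \<longleftrightarrow> p \<in> e"
    using p(1) inT edge_subset_frontier[OF assms(1,3)] frontier_subset_closed[OF T(2)] by blast
  ultimately show ?thesis
    using half_of_2_bounce_iff[of T v p] T \<open>v \<noteq> p\<close> vertex_in_frontier[OF assms(1,2)] by auto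
qed

lemma half_of_2_bounce_vertices_iff:
  assumes "convex_polygon T" "v extreme_point_of T" "w extreme_point_of T" "v \<noteq> w"
  shows "half_of_2_bounce T v w \<longleftrightarrow>
    disjnt (orthogonal_line v v w) (interior T) \<and> disjnt (orthogonal_line w v w) (interior T)"
  using half_of_2_bounce_iff[of T v w] convex_polygonD[OF assms(1)] assms
    vertex_in_frontier[OF assms(1)] by auto

theorem mainTheorem3:
  fixes T :: "(real^2) set"
  assumes "convex_polygon T"
  shows
    "(\<forall>e e'. parallel_edges T e e' \<longrightarrow>
        (\<forall>a \<in> rel_interior e. \<forall>b \<in> rel_interior e'.
           segment_orthogonal_to a b e \<and> segment_orthogonal_to a b e' \<longrightarrow>
             n_bounce_orbit T 2 (alternating a b) \<and> regular_orbit T (alternating a b)))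
     \<and>
     (\<forall>q. n_bounce_orbit T 2 q \<and> regular_orbit T q \<longrightarrow>
        (\<exists>e e' a b. parallel_edges T e e' \<and> a \<in> rel_interior e \<and> b \<in> rel_interior e' \<and>
           segment_orthogonal_to a b e \<and> segment_orthogonal_to a b e' \<and>
           orbit_trace q = orbit_trace (alternating a b)))
     \<and>
     (\<forall>v e p. v extreme_point_of T \<and> e edge_of T \<and> v \<notin> e \<and> altitude v p e \<longrightarrow>
        (half_of_2_bounce T v p \<longleftrightarrow>
           p \<in> e \<and> disjnt (orthogonal_line v v p) (interior T)))
     \<and>
     (\<forall>v w. v extreme_point_of T \<and> w extreme_point_of T \<and> v \<noteq> w \<longrightarrow>
        (half_of_2_bounce T v w \<longleftrightarrow>
           disjnt (orthogonal_line v v w) (interior T) \<and>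
           disjnt (orthogonal_line w v w) (interior T)))
     \<and>
     (\<forall>q. n_bounce_orbit T 2 q \<longrightarrow>
        (\<exists>e e' a b. parallel_edges T e e' \<and> a \<in> rel_interior e \<and> b \<in> rel_interior e' \<and>
           segment_orthogonal_to a b e \<and> segment_orthogonal_to a b e' \<and>
           orbit_trace q = orbit_trace (alternating a b))
      \<or> (\<exists>v e p. v extreme_point_of T \<and> e edge_of T \<and> v \<notin> e \<and> altitude v p e \<and>
           p \<in> e \<and> disjnt (orthogonal_line v v p) (interior T) \<and>
           orbit_trace q = orbit_trace (alternating v p))
      \<or> (\<exists>v w. v extreme_point_of T \<and> w extreme_point_of T \<and> v \<noteq> w \<and>
           disjnt (orthogonal_line v v w) (interior T) \<and>
           disjnt (orthogonal_line w v w) (interior T) \<and>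
           orbit_trace q = orbit_trace (alternating v w)))"
proof (intro conjI allI impI ballI)
  fix e e' a b
  assume "parallel_edges T e e'" "a \<in> rel_interior e" "b \<in> rel_interior e'"
    "segment_orthogonal_to a b e \<and> segment_orthogonal_to a b e'"
  then show "n_bounce_orbit T 2 (alternating a b)" "regular_orbit T (alternating a b)"
    using parallel_edges_imp_orbit[OF assms] n_bounce_orbit_2_alternating by blast+
next
  fix q assume q: "n_bounce_orbit T 2 q \<and> regular_orbit T q"
  define a b where "a = q 0" and "b = q 1"
  have half: "q = alternating a b" "half_of_2_bounce T a b"
    using q n_bounce_orbit_2_iff[of T q] by (auto simp: a_def b_def)
  have smooth: "smooth_point T a" "smooth_point T b"
    using q by (auto simp: regular_orbit_def a_def b_def)
  then have fr: "a \<in> frontier T" "b \<in> frontier T" by (auto simp: smooth_point_def)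
  obtain e where e: "e edge_of T" "a \<in> rel_interior e"
    using frontier_point_cases[OF assms fr(1)] vertex_not_smooth[OF assms] smooth(1) by blast
  obtain e' where e': "e' edge_of T" "b \<in> rel_interior e'"
    using frontier_point_cases[OF assms fr(2)] vertex_not_smooth[OF assms] smooth(2) by blast
  show "\<exists>e e' a b. parallel_edges T e e' \<and> a \<in> rel_interior e \<and> b \<in> rel_interior e' \<and>
       segment_orthogonal_to a b e \<and> segment_orthogonal_to a b e' \<and>
       orbit_trace q = orbit_trace (alternating a b)"
    using orbit_between_edges[OF assms half(2) e e'] e e' half(1) by blast
next
  fix v e p
  assume "v extreme_point_of T \<and> e edge_of T \<and> v \<notin> e \<and> altitude v p e"
  then show "half_of_2_bounce T v p \<longleftrightarrow> p \<in> e \<and> disjnt (orthogonal_line v v p) (interior T)"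
    using half_of_2_bounce_altitude_iff[OF assms] by blast
next
  fix v w
  assume "v extreme_point_of T \<and> w extreme_point_of T \<and> v \<noteq> w"
  then show "half_of_2_bounce T v w \<longleftrightarrow>
      disjnt (orthogonal_line v v w) (interior T) \<and> disjnt (orthogonal_line w v w) (interior T)"
    using half_of_2_bounce_vertices_iff[OF assms] by blast
next
  fix q assume q: "n_bounce_orbit T 2 q"
  define a b where "a = q 0" and "b = q 1"
  have half: "q = alternating a b" "half_of_2_bounce T a b"
    using q n_bounce_orbit_2_iff[of T q] by (auto simp: a_def b_def)
  then have fr: "a \<in> frontier T" "b \<in> frontier T" "a \<noteq> b"
    using half_of_2_bounce_iff[of T a b] convex_polygonD[OF assms] by auto
  have half': "half_of_2_bounce T b a" using half(2) half_of_2_bounce_commute by blast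
  have tr: "orbit_trace q = orbit_trace (alternating a b)"
    "orbit_trace q = orbit_trace (alternating b a)"
    using half(1) orbit_trace_alternating_swap by auto
  show "(\<exists>e e' a b. parallel_edges T e e' \<and> a \<in> rel_interior e \<and> b \<in> rel_interior e' \<and>
           segment_orthogonal_to a b e \<and> segment_orthogonal_to a b e' \<and>
           orbit_trace q = orbit_trace (alternating a b))
      \<or> (\<exists>v e p. v extreme_point_of T \<and> e edge_of T \<and> v \<notin> e \<and> altitude v p e \<and>
           p \<in> e \<and> disjnt (orthogonal_line v v p) (interior T) \<and>
           orbit_trace q = orbit_trace (alternating v p))
      \<or> (\<exists>v w. v extreme_point_of T \<and> w extreme_point_of T \<and> v \<noteq> w \<and>
           disjnt (orthogonal_line v v w) (interior T) \<and>
           disjnt (orthogonal_line w v w) (interior T) \<and>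
           orbit_trace q = orbit_trace (alternating v w))"
    (is "?edges \<or> ?mixed \<or> ?vertices")
    using assms fr(1)
  proof (cases rule: frontier_point_cases)
    case a: vertex
    show ?thesis
      using assms fr(2)
    proof (cases rule: frontier_point_cases)
      case b: vertex
      have ?vertices
        using half_of_2_bounce_vertices_iff[OF assms a b fr(3)] half(2) a b fr(3) tr by blast
      then show ?thesis by blast
    next
      case b: (edge e)
      have ?mixed using orbit_between_vertex_and_edge[OF assms half(2) b] a b tr by blast
      then show ?thesis by blast
    qed
  next
    case a: (edge e)
    show ?thesis
      using assms fr(2)
    proof (cases rule: frontier_point_cases)
      case b: vertex
      have ?mixed using orbit_between_vertex_and_edge[OF assms half' a] a b tr by blast
      then show ?thesis by blast
    next
      case b: (edge e')
      have ?edges using orbit_between_edges[OF assms half(2) a b] a b tr by blast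
      then show ?thesis by blast
    qed
  qed
qed

end
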